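(* Let $X$ be a finite-dimensional Euclidean space, let $A,B\subset X$ be closed, and let $\bar x\in A\cap B$. The following conditions are equivalent: (i) $\{A,B\}$ is intrinsically transversal at $\bar x$; (ii) $\widehat{\mathrm{itr}}_1[A,B](\bar x)>0$, i.e., there exist numbers $\alpha\in]0,1[$ and $\delta>0$ such that $$\max\left\{d\left(\frac{b-a}{\|a-b\|},N_A(a)\right),d\left(\frac{a-b}{\|a-b\|},N_B(b)\right)\right\}>\alpha$$ for all $a\in(A\setminus B)\cap\mathbb{B}_\delta(\bar x)$, $b\in(B\setminus A)\cap\mathbb{B}_\delta(\bar x)$; or equivalently, there exist numbers $\alpha\in]0,1[$ and $\delta>0$ such that $$\max\left\{\left\|\frac{b-a}{\|a-b\|}-v_1\right\|,\left\|\frac{a-b}{\|a-b\|}-v_2\right\|\right\}>\alpha$$ for all $a\in(A\setminus B)\cap\mathbb{B}_\delta(\bar x)$, $b\in(B\setminus A)\cap\mathbb{B}_\delta(\bar x)$, and all $v_1\in N_A(a)$ and $v_2\in N_B(b)$; the exact upper bound of all such $\alpha$ equals $\widehat{\mathrm{itr}}_1[A,B](\bar x)$; (iii) $\widehat{\mathrm{itr}}_2[A,B](\bar x)<1$, i.e., there exist numbers $\alpha\in]0,1[$ and $\delta>0$ such that $$\min\left\{\left\langle\frac{b-a}{\|a-b\|},v_1\right\rangle,\left\langle\frac{a-b}{\|a-b\|},v_2\right\rangle\right\}<\alpha$$ for all $a\in(A\setminus B)\cap\mathbb{B}_\delta(\bar x)$, $b\in(B\setminus A)\cap\mathbb{B}_\delta(\bar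 x)$, and all $v_1\in N_A(a)$ and $v_2\in N_B(b)$ with $\|v_1\|=\|v_2\|=1$; the exact lower bound of all such $\alpha$ equals $\widehat{\mathrm{itr}}_2[A,B](\bar x)$.
   Context: $X^*$ is identified with $X$ and $\langle\cdot,\cdot\rangle$ is the inner product. $\mathbb{B}_r(x)$ is the open ball with centre $x$ and radius $r$; $d(\cdot,\cdot)$ is the distance from a point to a set; $t_+:=\max\{t,0\}$. The supremum of the empty subset of $\mathbb{R}_+$ is taken to be $0$. Fréchet normal cone to $A$ at $x\in A$: $N_A(x)=\{v\in X\mid \limsup_{a\to x,\,a\in A\setminus\{x\}}\langle v,a-x\rangle/\|a-x\|\le 0\}$ (all of $X$ if $x$ is isolated in $A$). Intrinsic transversality: $\{A,B\}$ is intrinsically transversal at $\bar x$ if there exist numbers $\alpha\in]0,1[$ and $\delta>0$ such that $\|v_1+v_2\|>\alpha$ for all $a\in(A\setminus B)\cap\mathbb{B}_\delta(\bar x)$, $b\in(B\setminus A)\cap\mathbb{B}_\delta(\bar x)$, $x\in\mathbb{B}_\delta(\bar x)$ with $x\ne a$, $x\ne b$, $1-\delta<\frac{\|x-a\|}{\|x-b\|}<1+\delta$, and all $v_1\in N_A(a)\setminus\{0\}$, $v_2\in N_B(b)\setminus\{0\}$ satisfying $\|v_1\|+\|v_2\|=1$, $\frac{\langle v_1,x-a\rangle}{\|v_1\|\|x-a\|}>1-\delta$, $\frac{\langle v_2,x-b\rangle}{\|v_2\|\|x-b\|}>1-\delta$. Constants: $$\widehat{\mathrm{itr}}_1[A,B](\bar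 x):=\liminf_{\substack{a\to\bar x,\,b\to\bar x\\ a\in A\setminus B,\,b\in B\setminus A}}\max\left\{d\left(\tfrac{b-a}{\|a-b\|},N_A(a)\right),d\left(\tfrac{a-b}{\|a-b\|},N_B(b)\right)\right\},$$ $$\widehat{\mathrm{itr}}_2[A,B](\bar x):=\limsup_{\substack{a\to\bar x,\,b\to\bar x\\ a\in A\setminus B,\,b\in B\setminus A\\ v_1\in N_A(a),\,v_2\in N_B(b),\,\|v_1\|=\|v_2\|=1}}\left[\min\left\{\left\langle\tfrac{b-a}{\|a-b\|},v_1\right\rangle,\left\langle\tfrac{a-b}{\|a-b\|},v_2\right\rangle\right\}\right]_+,$$ where the liminf (limsup) means the limit as $\delta\downarrow0$ of the infimum (supremum) over $a,b\in\mathbb{B}_\delta(\bar x)$ subject to the listed constraints, with the conventions that the infimum and supremum over the empty set equal $1$ and $0$, respectively. *)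

theory Defs
  imports "HOL-Analysis.Analysis"
begin

text \<open>The filter \<open>at x within A\<close> excludes \<open>x\<close> itself. If \<open>x\<close> is isolated in \<open>A\<close> the filter is
  trivial, the upper limit is \<open>-\<infinity>\<close>, and the cone is the whole space.\<close>

definition frechet_normal_cone :: "'a::real_inner set \<Rightarrow> 'a \<Rightarrow> 'a set" where
  "frechet_normal_cone A x =
     {v. Limsup (at x within A) (\<lambda>a. ereal (inner v (a - x) / norm (a - x))) \<le> 0}"

definition intrinsically_transversal :: "'a::real_inner set \<Rightarrow> 'a set \<Rightarrow> 'a \<Rightarrow> bool" where
  "intrinsically_transversal A B xbar \<longleftrightarrow>
     (\<exists>\<alpha> \<delta>. 0 < \<alpha> \<and> \<alpha> < 1 \<and> 0 < \<delta> \<and>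
       (\<forall>a \<in> (A - B) \<inter> ball xbar \<delta>. \<forall>b \<in> (B - A) \<inter> ball xbar \<delta>. \<forall>x \<in> ball xbar \<delta>.
          x \<noteq> a \<and> x \<noteq> b \<and>
          1 - \<delta> < norm (x - a) / norm (x - b) \<and> norm (x - a) / norm (x - b) < 1 + \<delta> \<longrightarrow>
          (\<forall>v1 \<in> frechet_normal_cone A a - {0}. \<forall>v2 \<in> frechet_normal_cone B b - {0}.
             norm v1 + norm v2 = 1 \<and>
             inner v1 (x - a) / (norm v1 * norm (x - a)) > 1 - \<delta> \<and>
             inner v2 (x - b) / (norm v2 * norm (x - b)) > 1 - \<delta> \<longrightarrow>
             norm (v1 + v2) > \<alpha>)))"

text \<open>All suprema and infima below are of subsets of \<open>[0, 1]\<close>, with the conventions that the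
  supremum of the empty set is \<open>0\<close> and its infimum is \<open>1\<close> (in the library \<open>Sup {}\<close> and \<open>Inf {}\<close>
  are unspecified reals).\<close>

definition sup0 :: "real set \<Rightarrow> real" where
  "sup0 S = (if S = {} then 0 else Sup S)"

definition inf1 :: "real set \<Rightarrow> real" where
  "inf1 S = (if S = {} then 1 else Inf S)"

definition itr1 :: "'a::real_inner set \<Rightarrow> 'a set \<Rightarrow> 'a \<Rightarrow> real" where
  "itr1 A B xbar = Lim (at_right 0) (\<lambda>\<delta>. inf1
     {max (infdist ((b - a) /\<^sub>R norm (a - b)) (frechet_normal_cone A a))
          (infdist ((a - b) /\<^sub>R norm (a - b)) (frechet_normal_cone B b)) | a b.
        a \<in> (A - B) \<inter> ball xbar \<delta> \<and> b \<in> (B - A) \<inter> ball xbar \<delta>})"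

definition itr2 :: "'a::real_inner set \<Rightarrow> 'a set \<Rightarrow> 'a \<Rightarrow> real" where
  "itr2 A B xbar = Lim (at_right 0) (\<lambda>\<delta>. sup0
     {max (min (inner ((b - a) /\<^sub>R norm (a - b)) v1) (inner ((a - b) /\<^sub>R norm (a - b)) v2)) 0
        | a b v1 v2.
        a \<in> (A - B) \<inter> ball xbar \<delta> \<and> b \<in> (B - A) \<inter> ball xbar \<delta> \<and>
        v1 \<in> frechet_normal_cone A a \<and> v2 \<in> frechet_normal_cone B b \<and>
        norm v1 = 1 \<and> norm v2 = 1})"

definition itr1_dist_bounds :: "'a::real_inner set \<Rightarrow> 'a set \<Rightarrow> 'a \<Rightarrow> real set" where
  "itr1_dist_bounds A B xbar = {\<alpha>. 0 < \<alpha> \<and> \<alpha> < 1 \<and>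
     (\<exists>\<delta>>0. \<forall>a \<in> (A - B) \<inter> ball xbar \<delta>. \<forall>b \<in> (B - A) \<inter> ball xbar \<delta>.
        max (infdist ((b - a) /\<^sub>R norm (a - b)) (frechet_normal_cone A a))
            (infdist ((a - b) /\<^sub>R norm (a - b)) (frechet_normal_cone B b)) > \<alpha>)}"

definition itr1_norm_bounds :: "'a::real_inner set \<Rightarrow> 'a set \<Rightarrow> 'a \<Rightarrow> real set" where
  "itr1_norm_bounds A B xbar = {\<alpha>. 0 < \<alpha> \<and> \<alpha> < 1 \<and>
     (\<exists>\<delta>>0. \<forall>a \<in> (A - B) \<inter> ball xbar \<delta>. \<forall>b \<in> (B - A) \<inter> ball xbar \<delta>.
        \<forall>v1 \<in> frechet_normal_cone A a. \<forall>v2 \<in> frechet_normal_cone B b.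
          max (norm ((b - a) /\<^sub>R norm (a - b) - v1)) (norm ((a - b) /\<^sub>R norm (a - b) - v2)) > \<alpha>)}"

definition itr2_bounds :: "'a::real_inner set \<Rightarrow> 'a set \<Rightarrow> 'a \<Rightarrow> real set" where
  "itr2_bounds A B xbar = {\<alpha>. 0 < \<alpha> \<and> \<alpha> < 1 \<and>
     (\<exists>\<delta>>0. \<forall>a \<in> (A - B) \<inter> ball xbar \<delta>. \<forall>b \<in> (B - A) \<inter> ball xbar \<delta>.
        \<forall>v1 \<in> frechet_normal_cone A a. \<forall>v2 \<in> frechet_normal_cone B b.
          norm v1 = 1 \<and> norm v2 = 1 \<longrightarrow>
          min (inner ((b - a) /\<^sub>R norm (a - b)) v1) (inner ((a - b) /\<^sub>R norm (a - b)) v2) < \<alpha>)}"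

end

theory Submission
  imports Defs
begin

text \<open>
  For \<open>a \<in> A - B\<close> and \<open>b \<in> B - A\<close> let \<open>u\<close> be the unit vector from \<open>a\<close> towards \<open>b\<close>. Intrinsic
  transversality, \<open>itr1 > 0\<close> and \<open>itr2 < 1\<close> all say that \<open>u\<close> and \<open>- u\<close> cannot both be almost normal, to \<open>A\<close> at \<open>a\<close> and to \<open>B\<close> at
  \<open>b\<close> respectively, when \<open>a\<close> and \<open>b\<close> are close to the reference point.

  The constants \<open>itr1\<close> and \<open>itr2\<close> measure this by distance and by angle. The two are
  interchangeable because normal cones are cones. If \<open>v\<close> is a unit vector at an acute angle to \<open>u\<close>,
  then no multiple \<open>t v\<close> with \<open>t \<ge> 0\<close> comes closer to \<open>u\<close> than the sine of that angle
  (\<open>norm_diff_ge_of_angle\<close>), so small distances force large cosines; and for unit vectors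
  distance and cosine determine each other (\<open>norm_diff_unit_square\<close>), so large cosines force
  small distances.

  Intrinsic transversality involves an extra point \<open>x\<close> from which \<open>a\<close> and \<open>b\<close> are seen
  along almost normal directions. It implies \<open>itr2 < 1\<close> by taking for \<open>x\<close> the midpoint of \<open>a\<close> and
  \<open>b\<close>: if \<open>v\<^sub>1\<close> is close to \<open>u\<close> and \<open>v\<^sub>2\<close> close to \<open>- u\<close>, then \<open>v\<^sub>1 / 2 + v\<^sub>2 / 2\<close> is small.
  Conversely, if \<open>v\<^sub>1 + v\<^sub>2\<close> is small and \<open>v\<^sub>1\<close>, \<open>v\<^sub>2\<close> point almost along \<open>x - a\<close> and \<open>x - b\<close>, then
  \<open>x - a\<close> and \<open>x - b\<close> are almost opposite, so that \<open>x\<close> lies nearly on the segment between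
  \<open>a\<close> and \<open>b\<close>; hence \<open>v\<^sub>1\<close> and \<open>v\<^sub>2\<close> point almost along \<open>u\<close> and \<open>- u\<close>, against \<open>itr2 < 1\<close>.

  The exact bounds come from monotonicity: the constraint sets shrink with \<open>\<delta>\<close>, so
  the limit defining \<open>itr1\<close> is a supremum of infima and the one defining \<open>itr2\<close> an infimum of
  suprema (\<open>Lim_inf1_props\<close>, \<open>Lim_sup0_props\<close>). Each set of admissible \<open>\<alpha>\<close> is
  therefore the interval between \<open>0\<close> and \<open>itr1\<close>, or between \<open>itr2\<close> and \<open>1\<close>, up to
  the end point at the constant.
\<close>

section \<open>Frechet normal cones are cones\<close>

lemma frechet_normal_cone_iff:
  fixes A :: "'a::real_inner set"
  shows "v \<in> frechet_normal_cone A x \<longleftrightarrow>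
    (\<forall>e>0. \<forall>\<^sub>F a in at x within A. inner v (a - x) / norm (a - x) < e)"
proof -
  have "v \<in> frechet_normal_cone A x \<longleftrightarrow>
      (\<forall>y>0. \<forall>\<^sub>F a in at x within A. ereal (inner v (a - x) / norm (a - x)) < y)"
    unfolding frechet_normal_cone_def by (simp add: Limsup_le_iff)
  also have "\<dots> \<longleftrightarrow> (\<forall>e>0. \<forall>\<^sub>F a in at x within A. inner v (a - x) / norm (a - x) < e)"
  proof (intro iffI allI impI)
    fix e :: real
    assume "\<forall>y>0. \<forall>\<^sub>F a in at x within A. ereal (inner v (a - x) / norm (a - x)) < y" "0 < e"
    then show "\<forall>\<^sub>F a in at x within A. inner v (a - x) / norm (a - x) < e"
      by (auto dest: spec[of _ "ereal e"])
  next
    fix y :: ereal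
    assume *: "\<forall>e>0. \<forall>\<^sub>F a in at x within A. inner v (a - x) / norm (a - x) < e" and "0 < y"
    then obtain e where "0 < ereal e" "ereal e < y"
      using ereal_dense2 by blast
    then have "0 < e" by simp
    with * have "\<forall>\<^sub>F a in at x within A. inner v (a - x) / norm (a - x) < e" by blast
    then show "\<forall>\<^sub>F a in at x within A. ereal (inner v (a - x) / norm (a - x)) < y"
      by (rule eventually_mono) (meson \<open>ereal e < y\<close> less_ereal.simps(1) less_trans)
  qed
  finally show ?thesis .
qed

lemma zero_in_frechet_normal_cone: "0 \<in> frechet_normal_cone A x"
  by (simp add: frechet_normal_cone_iff)

lemma scaleR_in_frechet_normal_cone:
  assumes "v \<in> frechet_normal_cone A x" and "0 < t"
  shows "t *\<^sub>R v \<in> frechet_normal_cone A x"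
  unfolding frechet_normal_cone_iff
proof (intro allI impI)
  fix e :: real
  assume "0 < e"
  with assms have "\<forall>\<^sub>F a in at x within A. inner v (a - x) / norm (a - x) < e / t"
    unfolding frechet_normal_cone_iff by simp
  then show "\<forall>\<^sub>F a in at x within A. inner (t *\<^sub>R v) (a - x) / norm (a - x) < e"
    by eventually_elim (use \<open>0 < t\<close> in \<open>simp add: pos_less_divide_eq mult.commute\<close>)
qed

lemma sgn_in_frechet_normal_cone:
  "v \<in> frechet_normal_cone A x \<Longrightarrow> v \<noteq> 0 \<Longrightarrow> sgn v \<in> frechet_normal_cone A x"
  by (simp add: sgn_div_norm scaleR_in_frechet_normal_cone)

lemma infdist_frechet_normal_cone_le_norm:
  "infdist u (frechet_normal_cone A x) \<le> norm u"
  using infdist_le[OF zero_in_frechet_normal_cone, of u] by simp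

section \<open>Limits of infima and suprema over shrinking sets\<close>

text \<open>The infima increase as the sets shrink, so their limit exists and is a
  supremum. The last two claims turn the limit into statements about the elements of a single
  \<open>S d\<close>. The value \<open>1\<close> of \<open>inf1\<close> at the empty set is what makes the last one true when \<open>S d\<close> is
  empty, since then \<open>c\<close> is restricted by \<open>c \<le> 1\<close> only.\<close>

lemma Lim_inf1_props:
  fixes S :: "real \<Rightarrow> real set"
  assumes mono: "mono_on {0<..} S"
    and bounds: "\<And>d. S d \<subseteq> {0..1}"
  defines "L \<equiv> Lim (at_right 0) (\<lambda>d. inf1 (S d))"
  shows "((\<lambda>d. inf1 (S d)) \<longlongrightarrow> L) (at_right 0)" and "0 \<le> L" and "L \<le> 1"
    and "c < L \<Longrightarrow> \<exists>d>0. \<forall>s\<in>S d. c < s"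
    and "0 < d \<Longrightarrow> c \<le> 1 \<Longrightarrow> \<forall>s\<in>S d. c \<le> s \<Longrightarrow> c \<le> L"
proof -
  define G where "G d = inf1 (S d)" for d
  have bdd: "bdd_below (S d)" for d
    using bounds[of d] by (meson bdd_below_Icc bdd_below_mono)
  have G_ge: "c \<le> G d" if "c \<le> 1" "\<forall>s\<in>S d. c \<le> s" for c d
    using that by (auto simp: G_def inf1_def intro: cInf_greatest)
  have G_le: "G d \<le> s" if "s \<in> S d" for s d
    using that bdd by (auto simp: G_def inf1_def intro: cInf_lower)
  have G0: "0 \<le> G d" for d
    using bounds[of d] by (intro G_ge) auto
  have G1: "G d \<le> 1" for d
  proof (cases "S d = {}")
    case False
    then obtain s where "s \<in> S d" by blast
    then show ?thesis using G_le[of s d] bounds[of d] by force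
  qed (simp add: G_def inf1_def)
  have G_antimono: "G e \<le> G d" if "0 < d" "d \<le> e" for d e
    using mono_onD[OF mono, of d e] that by (intro G_ge G1) (auto intro: G_le)
  define M where "M = (SUP d\<in>{0<..}. G d)"
  have bddG: "bdd_above (G ` {0<..})"
    using G1 by (auto intro!: bdd_aboveI2)
  have G_le_M: "G d \<le> M" if "0 < d" for d
    unfolding M_def using that by (intro cSUP_upper bddG) auto
  have lim: "(G \<longlongrightarrow> M) (at_right 0)"
  proof (rule order_tendstoI)
    fix c assume "c < M"
    then obtain e where e: "0 < e" "c < G e"
      unfolding M_def by (subst (asm) less_cSUP_iff[OF _ bddG]) auto
    have "\<forall>\<^sub>F d in at_right 0. d \<in> {0<..<e}"
      using e(1) by (rule eventually_at_right_real)
    then show "\<forall>\<^sub>F d in at_right 0. c < G d"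
      by eventually_elim (use e G_antimono in \<open>force intro: less_le_trans\<close>)
  next
    fix c assume "M < c"
    have "\<forall>\<^sub>F d::real in at_right 0. 0 < d"
      by (rule eventually_at_right_less)
    then show "\<forall>\<^sub>F d in at_right 0. G d < c"
      by eventually_elim (use G_le_M \<open>M < c\<close> in \<open>force intro: le_less_trans\<close>)
  qed
  then have L: "L = M"
    unfolding L_def G_def by (intro tendsto_Lim) auto
  with lim show "((\<lambda>d. inf1 (S d)) \<longlongrightarrow> L) (at_right 0)"
    by (simp add: G_def[abs_def])
  show "0 \<le> L" using G0[of 1] G_le_M[of 1] L by simp
  show "L \<le> 1" unfolding L M_def using G1 by (intro cSUP_least) auto
  show "\<exists>d>0. \<forall>s\<in>S d. c < s" if "c < L"
  proof -
    from that obtain e where "0 < e" "c < G e"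
      unfolding L M_def by (subst (asm) less_cSUP_iff[OF _ bddG]) auto
    then show ?thesis using G_le by (meson less_le_trans)
  qed
  show "c \<le> L" if "0 < d" "c \<le> 1" "\<forall>s\<in>S d. c \<le> s"
    using G_ge[OF that(2,3)] G_le_M[OF that(1)] L by simp
qed

text \<open>The reflection \<open>s \<mapsto> 1 - s\<close> of the unit interval exchanges the two
  conventions for the empty set, which reduces limits of suprema to limits of infima.\<close>

lemma sup0_eq_one_minus_inf1:
  assumes "S \<subseteq> {0..1}"
  shows "sup0 S = 1 - inf1 ((\<lambda>s. 1 - s) ` S)"
proof (cases "S = {}")
  case False
  have "bdd_above S" "bdd_below ((\<lambda>s. 1 - s) ` S)"
    using assms by (auto intro!: bdd_aboveI[of _ 1] bdd_belowI2[of _ 0])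
  then have lower: "Inf ((\<lambda>s. 1 - s) ` S) \<le> 1 - s" and upper: "s \<le> Sup S" if "s \<in> S" for s
    using that by (auto intro: cINF_lower cSup_upper)
  have "Sup S \<le> 1 - Inf ((\<lambda>s. 1 - s) ` S)"
    using False lower by (intro cSup_least) (auto simp: algebra_simps)
  moreover have "1 - Sup S \<le> Inf ((\<lambda>s. 1 - s) ` S)"
    using False upper by (intro cINF_greatest) auto
  ultimately  show ?thesis using False by (simp add: sup0_def inf1_def)
qed (simp add: sup0_def inf1_def)

lemma Lim_sup0_props:
  fixes S :: "real \<Rightarrow> real set"
  assumes mono: "mono_on {0<..} S"
    and bounds: "\<And>d. S d \<subseteq> {0..1}"
  defines "L \<equiv> Lim (at_right 0) (\<lambda>d. sup0 (S d))"
  shows "0 \<le> L" and "L \<le> 1"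
    and "L < c \<Longrightarrow> \<exists>d>0. \<forall>s\<in>S d. s < c"
    and "0 < d \<Longrightarrow> 0 \<le> c \<Longrightarrow> \<forall>s\<in>S d. s \<le> c \<Longrightarrow> L \<le> c"
proof -
  define T where "T d = (\<lambda>s. 1 - s) ` S d" for d
  define K where "K = Lim (at_right 0) (\<lambda>d. inf1 (T d))"
  have mono': "mono_on {0<..} T"
    unfolding T_def by (intro mono_onI image_mono mono_onD[OF mono])
  have bounds': "T d \<subseteq> {0..1}" for d
    using bounds[of d] by (auto simp: T_def)
  note props = Lim_inf1_props[of T, OF mono' bounds', folded K_def]
  have "((\<lambda>d. sup0 (S d)) \<longlongrightarrow> 1 - K) (at_right 0)"
    using props(1) unfolding sup0_eq_one_minus_inf1[OF bounds] T_def[symmetric]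
    by (intro tendsto_intros)
  then have L: "L = 1 - K"
    unfolding L_def by (intro tendsto_Lim) auto
  show "0 \<le> L" "L \<le> 1" using props(2,3) L by simp_all
  show "\<exists>d>0. \<forall>s\<in>S d. s < c" if "L < c"
    using props(4)[of "1 - c"] that L by (auto simp: T_def)
  show "L \<le> c" if "0 < d" "0 \<le> c" "\<forall>s\<in>S d. s \<le> c"
    using props(5)[of d "1 - c"] that L by (auto simp: T_def)
qed

lemma sup0_eqI:
  assumes "{0<..<L} \<subseteq> S" and "S \<subseteq> {0<..L}" and "0 \<le> L"
  shows "sup0 S = L"
proof (cases "L = 0")
  case True
  with assms(2) have "S = {}" by auto
  with True show ?thesis by (simp add: sup0_def)
next
  case False
  with assms have ne: "{0<..<L} \<noteq> {}" by simp
  have "Sup {0<..<L} \<le> Sup S"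
    using assms ne by (intro cSup_subset_mono) (auto intro: bdd_above_mono[of "{0<..L}"])
  moreover have "Sup S \<le> L"
    using assms ne by (intro cSup_least) auto
  ultimately show ?thesis
    using ne assms(1) by (auto simp: sup0_def)
qed

lemma inf1_eqI:
  assumes "{L<..<1} \<subseteq> S" and "S \<subseteq> {L..<1}" and "L \<le> 1"
  shows "inf1 S = L"
proof (cases "L = 1")
  case True
  with assms(2) have "S = {}" by auto
  with True show ?thesis by (simp add: inf1_def)
next
  case False
  with assms have ne: "{L<..<1} \<noteq> {}" by simp
  have "Inf S \<le> Inf {L<..<1}"
    using assms ne by (intro cInf_superset_mono) (auto intro: bdd_below_mono[of "{L..<1}"])
  moreover have "L \<le> Inf S"
    using assms ne by (intro cInf_greatest) auto
  ultimately show ?thesis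
    using ne assms(1) by (auto simp: inf1_def)
qed

section \<open>The constants as exact bounds\<close>

lemma norm_unit_diff:
  assumes "a \<noteq> b"
  shows "norm ((b - a) /\<^sub>R norm (a - b)) = 1" and "norm ((a - b) /\<^sub>R norm (a - b)) = 1"
  using assms by (simp_all add: norm_minus_commute)

text \<open>The admissible \<open>\<alpha>\<close> are enclosed from both sides: the smaller of the
  two sets of bounds (for distances) is bounded below and the larger one (for individual normals)
  above, so a single pair of inclusions determines the suprema of both. The upper inclusion
  works because \<open>v1\<close> and \<open>v2\<close> range independently: two normals that nearly attain the
  two distances attain the maximum at once.\<close>

lemma itr1_nonneg: "0 \<le> itr1 A B x"
  and itr1_dist_bounds_supset: "{0<..<itr1 A B x} \<subseteq> itr1_dist_bounds A B x"
  and itr1_norm_bounds_subset: "itr1_norm_bounds A B x \<subseteq> {0<..itr1 A B x}"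
proof -
  define S where "S \<delta> = {max (infdist ((b - a) /\<^sub>R norm (a - b)) (frechet_normal_cone A a))
          (infdist ((a - b) /\<^sub>R norm (a - b)) (frechet_normal_cone B b)) | a b.
        a \<in> (A - B) \<inter> ball x \<delta> \<and> b \<in> (B - A) \<inter> ball x \<delta>}" for \<delta>
  have itr1: "itr1 A B x = Lim (at_right 0) (\<lambda>d. inf1 (S d))"
    unfolding itr1_def S_def ..
  have mono: "mono_on {0<..} S"
  proof (rule mono_onI)
    fix d e :: real assume "d \<le> e"
    then show "S d \<subseteq> S e" using subset_ball[of d e x] unfolding S_def by blast
  qed
  have bounds: "S d \<subseteq> {0..1}" for d
  proof
    fix s assume "s \<in> S d"
    then obtain a b where ab: "a \<in> A - B" "b \<in> B - A"
      and s: "s = max (infdist ((b - a) /\<^sub>R norm (a - b)) (frechet_normal_cone A a))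
          (infdist ((a - b) /\<^sub>R norm (a - b)) (frechet_normal_cone B b))"
      unfolding S_def by blast
    have "infdist ((b - a) /\<^sub>R norm (a - b)) (frechet_normal_cone A a) \<le> 1"
      using infdist_frechet_normal_cone_le_norm norm_unit_diff(1) ab by (metis DiffE)
    moreover have "infdist ((a - b) /\<^sub>R norm (a - b)) (frechet_normal_cone B b) \<le> 1"
      using infdist_frechet_normal_cone_le_norm norm_unit_diff(2) ab by (metis DiffE)
    ultimately show "s \<in> {0..1}" using s by (auto simp: le_max_iff_disj infdist_nonneg)
  qed
  note props = Lim_inf1_props[of S, OF mono bounds, folded itr1]
  show "0 \<le> itr1 A B x" by (rule props(2))
  show "{0<..<itr1 A B x} \<subseteq> itr1_dist_bounds A B x"
  proof
    fix \<alpha> assume \<alpha>: "\<alpha> \<in> {0<..<itr1 A B x}"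
    then obtain d where d: "0 < d" "\<forall>s\<in>S d. \<alpha> < s"
      using props(4)[of \<alpha>] by auto
    have "\<forall>a \<in> (A - B) \<inter> ball x d. \<forall>b \<in> (B - A) \<inter> ball x d.
        \<alpha> < max (infdist ((b - a) /\<^sub>R norm (a - b)) (frechet_normal_cone A a))
          (infdist ((a - b) /\<^sub>R norm (a - b)) (frechet_normal_cone B b))"
      using d(2) unfolding S_def by blast
    then show "\<alpha> \<in> itr1_dist_bounds A B x"
      using \<alpha> d(1) props(3) by (auto simp: itr1_dist_bounds_def)
  qed
  show "itr1_norm_bounds A B x \<subseteq> {0<..itr1 A B x}"
  proof
    fix \<alpha> assume "\<alpha> \<in> itr1_norm_bounds A B x"
    then obtain d where \<alpha>: "0 < \<alpha>" "\<alpha> < 1" and "0 < d"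
      and d: "\<And>a b v1 v2. \<lbrakk>a \<in> (A - B) \<inter> ball x d; b \<in> (B - A) \<inter> ball x d;
          v1 \<in> frechet_normal_cone A a; v2 \<in> frechet_normal_cone B b\<rbrakk> \<Longrightarrow>
          \<alpha> < max (norm ((b - a) /\<^sub>R norm (a - b) - v1)) (norm ((a - b) /\<^sub>R norm (a - b) - v2))"
      unfolding itr1_norm_bounds_def by blast
    have near: "\<exists>v\<in>N. dist u v < r" if "w \<in> N" "infdist u N < r" for u w :: 'a and N r
      using that by (auto simp: infdist_def cINF_less_iff split: if_splits)
    have "\<alpha> \<le> s" if s: "s \<in> S d" for s
    proof (rule ccontr)
      assume "\<not> \<alpha> \<le> s"
      obtain a b where ab: "a \<in> (A - B) \<inter> ball x d" "b \<in> (B - A) \<inter> ball x d"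
        and s: "s = max (infdist ((b - a) /\<^sub>R norm (a - b)) (frechet_normal_cone A a))
          (infdist ((a - b) /\<^sub>R norm (a - b)) (frechet_normal_cone B b))"
        using s unfolding S_def by blast
      have "infdist ((b - a) /\<^sub>R norm (a - b)) (frechet_normal_cone A a) < \<alpha>"
        "infdist ((a - b) /\<^sub>R norm (a - b)) (frechet_normal_cone B b) < \<alpha>"
        using \<open>\<not> \<alpha> \<le> s\<close> s by auto
      then obtain v1 v2 where v: "v1 \<in> frechet_normal_cone A a" "v2 \<in> frechet_normal_cone B b"
        "dist ((b - a) /\<^sub>R norm (a - b)) v1 < \<alpha>" "dist ((a - b) /\<^sub>R norm (a - b)) v2 < \<alpha>"
        using near[OF zero_in_frechet_normal_cone] by metis
      then show False using d[OF ab v(1,2)] by (simp add: dist_norm)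
    qed
    then have "\<alpha> \<le> itr1 A B x"
      using props(5)[OF \<open>0 < d\<close>] \<alpha> by auto
    with \<alpha> show "\<alpha> \<in> {0<..itr1 A B x}" by simp
  qed
qed

lemma itr1_dist_bounds_subset_norm_bounds:
  "itr1_dist_bounds A B x \<subseteq> itr1_norm_bounds A B x"
proof -
  have "\<alpha> < max (norm (u - v1)) (norm (w - v2))"
    if "\<alpha> < max (infdist u M) (infdist w N)" "v1 \<in> M" "v2 \<in> N" for \<alpha> and u w v1 v2 :: 'a and M N
    using that(1) infdist_le[OF that(2), of u] infdist_le[OF that(3), of w]
    by (auto simp: dist_norm less_max_iff_disj)
  then show ?thesis
    unfolding itr1_dist_bounds_def itr1_norm_bounds_def by blast
qed

text \<open>Passing to the positive part in \<open>itr2\<close> does not affect the comparison with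
  \<open>\<alpha>\<close>, because admissible \<open>\<alpha>\<close> are positive.\<close>

lemma itr2_le_1: "itr2 A B x \<le> 1"
  and itr2_bounds_supset: "{itr2 A B x<..<1} \<subseteq> itr2_bounds A B x"
  and itr2_bounds_subset: "itr2_bounds A B x \<subseteq> {itr2 A B x..<1}"
proof -
  define S where "S \<delta> =
     {max (min (inner ((b - a) /\<^sub>R norm (a - b)) v1) (inner ((a - b) /\<^sub>R norm (a - b)) v2)) 0
        | a b v1 v2.
        a \<in> (A - B) \<inter> ball x \<delta> \<and> b \<in> (B - A) \<inter> ball x \<delta> \<and>
        v1 \<in> frechet_normal_cone A a \<and> v2 \<in> frechet_normal_cone B b \<and>
        norm v1 = 1 \<and> norm v2 = 1}" for \<delta>
  have itr2: "itr2 A B x = Lim (at_right 0) (\<lambda>d. sup0 (S d))"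
    unfolding itr2_def S_def ..
  have mono: "mono_on {0<..} S"
  proof (rule mono_onI)
    fix d e :: real assume "d \<le> e"
    then show "S d \<subseteq> S e" using subset_ball[of d e x] unfolding S_def by blast
  qed
  have bounds: "S d \<subseteq> {0..1}" for d
  proof
    fix s assume "s \<in> S d"
    then obtain a b v1 v2 where ab: "a \<in> A - B" "b \<in> B - A" and "norm v1 = 1"
      and s: "s = max (min (inner ((b - a) /\<^sub>R norm (a - b)) v1)
                           (inner ((a - b) /\<^sub>R norm (a - b)) v2)) 0"
      unfolding S_def by blast
    have "inner ((b - a) /\<^sub>R norm (a - b)) v1 \<le> 1"
      using norm_cauchy_schwarz[of "(b - a) /\<^sub>R norm (a - b)" v1] \<open>norm v1 = 1\<close>
        norm_unit_diff(1)[of a b] ab by fastforce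
    then show "s \<in> {0..1}" using s by (auto simp: min_le_iff_disj)
  qed
  note props = Lim_sup0_props[of S, OF mono bounds, folded itr2]
  show "itr2 A B x \<le> 1" by (rule props)
  show "{itr2 A B x<..<1} \<subseteq> itr2_bounds A B x"
  proof
    fix \<alpha> assume \<alpha>: "\<alpha> \<in> {itr2 A B x<..<1}"
    then obtain d where d: "0 < d" "\<forall>s\<in>S d. s < \<alpha>"
      using props(3)[of \<alpha>] by auto
    have "0 < \<alpha>" using \<alpha> props(1) by auto
    have "min (inner ((b - a) /\<^sub>R norm (a - b)) v1) (inner ((a - b) /\<^sub>R norm (a - b)) v2) < \<alpha>"
      if "a \<in> (A - B) \<inter> ball x d" "b \<in> (B - A) \<inter> ball x d"
        "v1 \<in> frechet_normal_cone A a" "v2 \<in> frechet_normal_cone B b" "norm v1 = 1" "norm v2 = 1"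
      for a b v1 v2
    proof -
      have "max (min (inner ((b - a) /\<^sub>R norm (a - b)) v1) (inner ((a - b) /\<^sub>R norm (a - b)) v2)) 0
          \<in> S d"
        unfolding S_def using that by blast
      with d(2) show ?thesis by (meson max_less_iff_conj)
    qed
    then show "\<alpha> \<in> itr2_bounds A B x"
      using \<alpha> \<open>0 < \<alpha>\<close> d(1) unfolding itr2_bounds_def by auto
  qed
  show "itr2_bounds A B x \<subseteq> {itr2 A B x..<1}"
  proof
    fix \<alpha> assume "\<alpha> \<in> itr2_bounds A B x"
    then obtain d where \<alpha>: "0 < \<alpha>" "\<alpha> < 1" and "0 < d"
      and d: "\<And>a b v1 v2. \<lbrakk>a \<in> (A - B) \<inter> ball x d; b \<in> (B - A) \<inter> ball x d;
          v1 \<in> frechet_normal_cone A a; v2 \<in> frechet_normal_cone B b; norm v1 = 1; norm v2 = 1\<rbrakk> \<Longrightarrow>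
          min (inner ((b - a) /\<^sub>R norm (a - b)) v1) (inner ((a - b) /\<^sub>R norm (a - b)) v2) < \<alpha>"
      unfolding itr2_bounds_def by blast
    have "\<forall>s\<in>S d. s \<le> \<alpha>"
      unfolding S_def using d \<open>0 < \<alpha>\<close> by (fastforce intro: less_imp_le)
    then have "itr2 A B x \<le> \<alpha>"
      using props(4)[OF \<open>0 < d\<close>] \<alpha> by auto
    with \<alpha> show "\<alpha> \<in> {itr2 A B x..<1}" by simp
  qed
qed

section \<open>Distances versus angles\<close>

lemma norm_diff_unit_square:
  fixes u v :: "'a::real_inner"
  assumes "norm u = 1" and "norm v = 1"
  shows "(norm (u - v))\<^sup>2 = 2 - 2 * inner u v"
  using assms by (simp add: power2_norm_eq_inner inner_diff inner_commute norm_eq_1)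

lemma norm_diff_le_unit:
  fixes u v :: "'a::real_inner"
  assumes "norm u = 1" and "norm v = 1" and "0 \<le> r" and "1 - r\<^sup>2 / 2 \<le> inner u v"
  shows "norm (u - v) \<le> r"
proof (rule power2_le_imp_le)
  show "(norm (u - v))\<^sup>2 \<le> r\<^sup>2" using assms by (simp add: norm_diff_unit_square)
qed fact

text \<open>As \<open>sgn v\<close> is the unit vector along \<open>v\<close>, this bounds the distance from \<open>u\<close>
  to a whole ray by the sine of the angle: minimising \<open>1 - 2 t c + t\<^sup>2\<close> over the length
  \<open>t\<close> gives \<open>1 - c\<^sup>2\<close>. For \<open>v = 0\<close> we have \<open>sgn v = 0\<close>, and the bound persists.\<close>

lemma norm_diff_ge_of_angle:
  fixes u v :: "'a::real_inner"
  assumes "norm u = 1" and "0 \<le> c" and "inner u (sgn v) \<le> c"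
  shows "1 - c\<^sup>2 \<le> (norm (u - v))\<^sup>2"
proof -
  have "inner u v \<le> c * norm v"
    using assms(3) by (cases "v = 0") (simp_all add: sgn_div_norm field_simps)
  moreover have "(norm (u - v))\<^sup>2 = 1 - 2 * inner u v + (norm v)\<^sup>2"
    using assms(1) by (simp add: power2_norm_eq_inner inner_diff inner_commute norm_eq_1)
  moreover have "0 \<le> (norm v - c)\<^sup>2" by simp
  ultimately show ?thesis by (simp add: power2_diff mult.commute)
qed

text \<open>An upper bound \<open>\<alpha>\<close> for cosines gives the lower bound
  \<open>sqrt (1 - \<alpha>\<^sup>2)\<close> for distances to the cones, and a lower bound \<open>\<alpha>\<close> for distances gives the
  upper bound \<open>1 - \<alpha>\<^sup>2 / 2\<close> for cosines of unit normals.\<close>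

lemma itr2_bounds_nonempty_iff:
  "(\<exists>\<alpha>. \<alpha> \<in> itr2_bounds A B x) \<longleftrightarrow> (\<exists>\<alpha>. \<alpha> \<in> itr1_norm_bounds A B x)"
proof
  assume "\<exists>\<alpha>. \<alpha> \<in> itr2_bounds A B x"
  then obtain \<alpha> d where \<alpha>: "0 < \<alpha>" "\<alpha> < 1" and "0 < d"
    and d: "\<And>a b v1 v2. \<lbrakk>a \<in> (A - B) \<inter> ball x d; b \<in> (B - A) \<inter> ball x d;
        v1 \<in> frechet_normal_cone A a; v2 \<in> frechet_normal_cone B b; norm v1 = 1; norm v2 = 1\<rbrakk> \<Longrightarrow>
        min (inner ((b - a) /\<^sub>R norm (a - b)) v1) (inner ((a - b) /\<^sub>R norm (a - b)) v2) < \<alpha>"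
    unfolding itr2_bounds_def by blast
  \<comment> \<open>Halving turns the weak inequality between norms and the sine into a strict one.\<close>
  define \<beta> where "\<beta> = sqrt (1 - \<alpha>\<^sup>2) / 2"
  have "0 < \<alpha>\<^sup>2" "\<alpha>\<^sup>2 < 1" using \<alpha> by (auto simp: power_less_one_iff abs_square_less_1)
  then have "sqrt (1 - \<alpha>\<^sup>2) < 1" "0 < sqrt (1 - \<alpha>\<^sup>2)" "0 < 1 - \<alpha>\<^sup>2"
    by simp_all
  then have \<beta>: "0 < \<beta>" "\<beta> < 1" "\<beta>\<^sup>2 < 1 - \<alpha>\<^sup>2"
    unfolding \<beta>_def by (linarith, linarith, simp add: power_divide)
  have "\<beta> < max (norm ((b - a) /\<^sub>R norm (a - b) - v1)) (norm ((a - b) /\<^sub>R norm (a - b) - v2))"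
    if ab: "a \<in> (A - B) \<inter> ball x d" "b \<in> (B - A) \<inter> ball x d"
      and v: "v1 \<in> frechet_normal_cone A a" "v2 \<in> frechet_normal_cone B b" for a b v1 v2
  proof -
    have "a \<noteq> b" using ab by auto
    have far: "\<beta> < norm (u - v)" if "norm u = 1" "inner u (sgn v) \<le> \<alpha>" for u v :: 'a
      using norm_diff_ge_of_angle[OF that(1) _ that(2)] \<alpha>(1) \<beta>(3)
      by (intro power2_less_imp_less[of \<beta>]) auto
    have "inner ((b - a) /\<^sub>R norm (a - b)) (sgn v1) \<le> \<alpha> \<or>
        inner ((a - b) /\<^sub>R norm (a - b)) (sgn v2) \<le> \<alpha>"
    proof (cases "v1 = 0 \<or> v2 = 0")
      case True
      then show ?thesis using \<alpha> by auto
    next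
      case False
      then show ?thesis
        using d[OF ab sgn_in_frechet_normal_cone[OF v(1)] sgn_in_frechet_normal_cone[OF v(2)]]
        by (auto simp: norm_sgn min_less_iff_disj)
    qed
    then show ?thesis
      using far norm_unit_diff[OF \<open>a \<noteq> b\<close>] by (metis less_max_iff_disj)
  qed
  then show "\<exists>\<alpha>. \<alpha> \<in> itr1_norm_bounds A B x"
    unfolding itr1_norm_bounds_def using \<beta> \<open>0 < d\<close> by blast
next
  assume "\<exists>\<alpha>. \<alpha> \<in> itr1_norm_bounds A B x"
  then obtain \<alpha> d where \<alpha>: "0 < \<alpha>" "\<alpha> < 1" and "0 < d"
    and d: "\<And>a b v1 v2. \<lbrakk>a \<in> (A - B) \<inter> ball x d; b \<in> (B - A) \<inter> ball x d;
        v1 \<in> frechet_normal_cone A a; v2 \<in> frechet_normal_cone B b\<rbrakk> \<Longrightarrow>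
        \<alpha> < max (norm ((b - a) /\<^sub>R norm (a - b) - v1)) (norm ((a - b) /\<^sub>R norm (a - b) - v2))"
    unfolding itr1_norm_bounds_def by blast
  define \<beta> where "\<beta> = 1 - \<alpha>\<^sup>2 / 2"
  have "0 < \<alpha>\<^sup>2" "\<alpha>\<^sup>2 < 1" using \<alpha> by (auto simp: power_less_one_iff abs_square_less_1)
  then have \<beta>: "0 < \<beta>" "\<beta> < 1" by (auto simp: \<beta>_def)
  have "min (inner ((b - a) /\<^sub>R norm (a - b)) v1) (inner ((a - b) /\<^sub>R norm (a - b)) v2) < \<beta>"
    if ab: "a \<in> (A - B) \<inter> ball x d" "b \<in> (B - A) \<inter> ball x d"
      and v: "v1 \<in> frechet_normal_cone A a" "v2 \<in> frechet_normal_cone B b"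
      and unit: "norm v1 = 1" "norm v2 = 1" for a b v1 v2
  proof (rule ccontr)
    assume "\<not> ?thesis"
    then have inn: "\<beta> \<le> inner ((b - a) /\<^sub>R norm (a - b)) v1" "\<beta> \<le> inner ((a - b) /\<^sub>R norm (a - b)) v2"
      by simp_all
    have "a \<noteq> b" using ab by auto
    have "norm ((b - a) /\<^sub>R norm (a - b) - v1) \<le> \<alpha>"
      using norm_unit_diff[OF \<open>a \<noteq> b\<close>] unit(1) inn(1) \<alpha>(1) unfolding \<beta>_def
      by (intro norm_diff_le_unit) auto
    moreover have "norm ((a - b) /\<^sub>R norm (a - b) - v2) \<le> \<alpha>"
      using norm_unit_diff(2)[OF \<open>a \<noteq> b\<close>] unit(2) inn(2) \<alpha>(1) unfolding \<beta>_def
      by (intro norm_diff_le_unit) auto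
    ultimately show False using d[OF ab v] by simp
  qed
  then show "\<exists>\<alpha>. \<alpha> \<in> itr2_bounds A B x"
    unfolding itr2_bounds_def using \<beta> \<open>0 < d\<close> by blast
qed

section \<open>Intrinsic transversality\<close>

text \<open>The midpoint \<open>m\<close> of \<open>a\<close> and \<open>b\<close> is an admissible test point: it is
  equidistant from both, stays in the ball by convexity, and sees \<open>a\<close> and \<open>b\<close> along
  exactly \<open>u\<close> and \<open>- u\<close>.\<close>

lemma intrinsically_transversal_imp_itr2_bounds:
  assumes "intrinsically_transversal A B x"
  shows "\<exists>\<alpha>. \<alpha> \<in> itr2_bounds A B x"
proof -
  from assms obtain \<alpha> d where \<alpha>: "0 < \<alpha>" "\<alpha> < 1" and "0 < d"
    and d: "\<forall>a \<in> (A - B) \<inter> ball x d. \<forall>b \<in> (B - A) \<inter> ball x d. \<forall>y \<in> ball x d.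
        y \<noteq> a \<and> y \<noteq> b \<and>
        1 - d < norm (y - a) / norm (y - b) \<and> norm (y - a) / norm (y - b) < 1 + d \<longrightarrow>
        (\<forall>v1 \<in> frechet_normal_cone A a - {0}. \<forall>v2 \<in> frechet_normal_cone B b - {0}.
           norm v1 + norm v2 = 1 \<and>
           inner v1 (y - a) / (norm v1 * norm (y - a)) > 1 - d \<and>
           inner v2 (y - b) / (norm v2 * norm (y - b)) > 1 - d \<longrightarrow>
           norm (v1 + v2) > \<alpha>)"
    unfolding intrinsically_transversal_def by (elim exE conjE) (rule that)
  \<comment> \<open>The first term makes the angles at the midpoint admissible, the second puts unit normals
    with cosine at least \<open>\<beta>\<close> within distance \<open>\<alpha>\<close> of \<open>u\<close> and \<open>- u\<close>.\<close>
  define \<beta> where "\<beta> = max (1 - d / 2) (1 - \<alpha>\<^sup>2 / 2)"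
  have "0 < \<alpha>\<^sup>2" "\<alpha>\<^sup>2 < 1" using \<alpha> by (auto simp: power_less_one_iff abs_square_less_1)
  then have \<beta>: "0 < \<beta>" "\<beta> < 1" "1 - d < \<beta>" "1 - \<alpha>\<^sup>2 / 2 \<le> \<beta>"
    using \<open>0 < d\<close> by (auto simp: \<beta>_def less_max_iff_disj)
  have "min (inner ((b - a) /\<^sub>R norm (a - b)) v1) (inner ((a - b) /\<^sub>R norm (a - b)) v2) < \<beta>"
    if ab: "a \<in> (A - B) \<inter> ball x d" "b \<in> (B - A) \<inter> ball x d"
      and v: "v1 \<in> frechet_normal_cone A a" "v2 \<in> frechet_normal_cone B b"
      and unit: "norm v1 = 1" "norm v2 = 1" for a b v1 v2
  proof (rule ccontr)
    assume "\<not> ?thesis"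
    define u where "u = (b - a) /\<^sub>R norm (a - b)"
    have mu: "(a - b) /\<^sub>R norm (a - b) = - u"
      unfolding u_def scaleR_minus_right[symmetric] minus_diff_eq ..
    from \<open>\<not> ?thesis\<close> have inn: "\<beta> \<le> inner u v1" "\<beta> \<le> inner (- u) v2"
      unfolding mu u_def[symmetric] by simp_all
    have "a \<noteq> b" using ab by auto
    have u: "norm u = 1" using norm_unit_diff[OF \<open>a \<noteq> b\<close>] by (simp add: u_def)
    define m where "m = midpoint a b"
    define r where "r = norm (a - b) / 2"
    have r: "0 < r" using \<open>a \<noteq> b\<close> by (simp add: r_def)
    have ru: "r *\<^sub>R u = (1 / 2) *\<^sub>R (b - a)"
      using \<open>a \<noteq> b\<close> by (simp add: r_def u_def)
    have half_scale: "w = (1 / 2) *\<^sub>R z" if "2 *\<^sub>R w = z" for w z :: 'a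
      unfolding that[symmetric] by simp
    have "2 *\<^sub>R (m - a) = b - a" "2 *\<^sub>R (m - b) = - (b - a)"
      by (simp_all add: m_def midpoint_def scaleR_right_diff_distrib scaleR_2)
    then have ma: "m - a = r *\<^sub>R u" and mb: "m - b = r *\<^sub>R (- u)"
      using half_scale[of "m - a" "b - a"] half_scale[of "m - b" "- (b - a)"]
      by (simp_all only: ru scaleR_minus_right)
    have "m \<in> ball x d"
      using ab convex_ball[of x d] unfolding m_def
      by (metis IntD2 convex_contains_segment midpoint_in_closed_segment subsetD)
    have "\<alpha> < norm (v1 /\<^sub>R 2 + v2 /\<^sub>R 2)"
    proof (rule d[rule_format, OF ab \<open>m \<in> ball x d\<close>])
      show "m \<noteq> a \<and> m \<noteq> b \<and> 1 - d < norm (m - a) / norm (m - b) \<and>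
          norm (m - a) / norm (m - b) < 1 + d"
      proof (intro conjI)
        show "m \<noteq> a" "m \<noteq> b" using \<open>a \<noteq> b\<close> by (simp_all add: m_def)
      qed (use u r \<open>0 < d\<close> in \<open>simp_all add: ma mb\<close>)
      show "v1 /\<^sub>R 2 \<in> frechet_normal_cone A a - {0}" "v2 /\<^sub>R 2 \<in> frechet_normal_cone B b - {0}"
        using v unit by (auto intro: scaleR_in_frechet_normal_cone)
      show "norm (v1 /\<^sub>R 2) + norm (v2 /\<^sub>R 2) = 1 \<and>
          inner (v1 /\<^sub>R 2) (m - a) / (norm (v1 /\<^sub>R 2) * norm (m - a)) > 1 - d \<and>
          inner (v2 /\<^sub>R 2) (m - b) / (norm (v2 /\<^sub>R 2) * norm (m - b)) > 1 - d"
        using inn \<beta>(3) r u unit unfolding ma mb by (simp add: inner_commute)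
    qed
    moreover have "norm (v1 /\<^sub>R 2 + v2 /\<^sub>R 2) \<le> \<alpha>"
    proof -
      have "norm (u - v1) \<le> \<alpha>" "norm (- u - v2) \<le> \<alpha>"
        using inn \<beta>(4) u unit \<alpha> by (auto intro!: norm_diff_le_unit)
      then have "norm ((u - v1) + (- u - v2)) \<le> \<alpha> + \<alpha>"
        by (intro norm_triangle_mono)
      moreover have "(u - v1) + (- u - v2) = - 2 *\<^sub>R (v1 /\<^sub>R 2 + v2 /\<^sub>R 2)"
        by (simp add: scaleR_right_distrib)
      ultimately have "\<bar>- 2\<bar> * norm (v1 /\<^sub>R 2 + v2 /\<^sub>R 2) \<le> \<alpha> + \<alpha>"
        by (simp only: norm_scaleR)
      then show ?thesis by linarith
    qed
    ultimately show False by simp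
  qed
  then show ?thesis
    unfolding itr2_bounds_def using \<beta> \<open>0 < d\<close> by blast
qed

text \<open>If two vectors nearly cancel, their norms nearly agree, so their
  directions nearly cancel as well. The assumptions keep both norms at least \<open>1 / 4\<close>, which
  makes normalisation harmless: dividing an error of \<open>2 r\<close> by such a norm costs a factor of
  at most \<open>4\<close>.\<close>

lemma norm_sgn_add_sgn_le:
  fixes v w :: "'a::real_inner"
  assumes "norm v + norm w = 1" and "norm (v + w) \<le> r" and "r \<le> 1 / 2"
  shows "norm (sgn v + sgn w) \<le> 8 * r"
proof -
  have diff: "\<bar>norm v - norm w\<bar> \<le> r"
    using norm_triangle_ineq3[of v "- w"] assms(2) by simp
  then have nv: "1 / 4 \<le> norm v" "1/4 \<le> norm w" using assms by auto
  have "norm v *\<^sub>R (sgn v + sgn w) = (v + w) + (norm v - norm w) *\<^sub>R sgn w"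
  proof -
    have "v \<noteq> 0" "w \<noteq> 0" using nv by auto
    then have "norm v *\<^sub>R sgn v = v" "norm w *\<^sub>R sgn w = w" by (simp_all add: sgn_div_norm)
    then show ?thesis by (simp add: algebra_simps)
  qed
  then have "norm v * norm (sgn v + sgn w) = norm ((v + w) + (norm v - norm w) *\<^sub>R sgn w)"
    by (metis norm_scaleR abs_norm_cancel)
  also have "\<dots> \<le> r + r"
    using assms(2) diff nv by (intro norm_triangle_mono) (auto simp: norm_sgn)
  finally have "norm v * norm (sgn v + sgn w) \<le> 2 * r" by simp
  moreover have "1 / 4 * norm (sgn v + sgn w) \<le> norm v * norm (sgn v + sgn w)"
    using nv by (intro mult_right_mono) auto
  ultimately show ?thesis by simp
qed

text \<open>Write \<open>b - a = r p - s q\<close> with \<open>p\<close>, \<open>q\<close> the directions of \<open>y - a\<close>,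
  \<open>y - b\<close> and \<open>r\<close>, \<open>s\<close> the distances. If the normal directions \<open>e\<close>, \<open>f\<close> are close to
  \<open>p\<close>, \<open>q\<close> and nearly opposite to each other, then the inner product of \<open>b - a\<close> with \<open>e\<close> is
  at least \<open>\<beta> (r + s)\<close>, hence at least \<open>\<beta>\<close> times the norm of \<open>b - a\<close> by the triangle
  inequality; likewise for \<open>a - b\<close> and \<open>f\<close>. This contradicts \<open>\<beta>\<close> being a bound.\<close>

lemma itr2_bounds_imp_intrinsically_transversal:
  assumes "\<beta> \<in> itr2_bounds A B x"
  shows "intrinsically_transversal A B x"
proof -
  from assms obtain d where \<beta>: "0 < \<beta>" "\<beta> < 1" and "0 < d"
    and d: "\<And>a b v1 v2. \<lbrakk>a \<in> (A - B) \<inter> ball x d; b \<in> (B - A) \<inter> ball x d;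
        v1 \<in> frechet_normal_cone A a; v2 \<in> frechet_normal_cone B b; norm v1 = 1; norm v2 = 1\<rbrakk> \<Longrightarrow>
        min (inner ((b - a) /\<^sub>R norm (a - b)) v1) (inner ((a - b) /\<^sub>R norm (a - b)) v2) < \<beta>"
    unfolding itr2_bounds_def by blast
  \<comment> \<open>Two errors of size \<open>\<eta>\<close> must fit between \<open>1\<close> and \<open>\<beta>\<close>: one from the deviation between
    \<open>e\<close> and \<open>f\<close>, one from that between a normal and its viewing direction.\<close>
  define \<eta> where "\<eta> = (1 - \<beta>) / 2"
  \<comment> \<open>Unit vectors with cosine at least \<open>1 - \<eta>\<^sup>2 / 2\<close> are within distance \<open>\<eta>\<close>.\<close>
  define \<delta> where "\<delta> = min d (\<eta>\<^sup>2 / 2)"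
  have \<eta>: "0 < \<eta>" "\<eta> < 1 / 2" "\<beta> = 1 - 2 * \<eta>" using \<beta> by (auto simp: \<eta>_def field_simps)
  have \<delta>: "0 < \<delta>" "\<delta> \<le> d" "\<delta> \<le> \<eta>\<^sup>2 / 2" using \<eta> \<open>0 < d\<close> by (auto simp: \<delta>_def)
  have "\<eta>\<^sup>2 \<le> \<eta>" using \<eta> by (simp add: power2_eq_square mult_left_le)
  have "norm (v1 + v2) > \<eta> / 8"
    if ab: "a \<in> (A - B) \<inter> ball x \<delta>" "b \<in> (B - A) \<inter> ball x \<delta>" and y: "y \<noteq> a" "y \<noteq> b"
      and v: "v1 \<in> frechet_normal_cone A a - {0}" "v2 \<in> frechet_normal_cone B b - {0}"
      and sum1: "norm v1 + norm v2 = 1"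
      and ang: "inner v1 (y - a) / (norm v1 * norm (y - a)) > 1 - \<delta>"
        "inner v2 (y - b) / (norm v2 * norm (y - b)) > 1 - \<delta>"
    for a b y v1 v2
  proof (rule ccontr)
    assume small: "\<not> ?thesis"
    define e f p q where "e = sgn v1" and "f = sgn v2" and "p = sgn (y - a)" and "q = sgn (y - b)"
    have unit: "norm e = 1" "norm f = 1" "norm p = 1" "norm q = 1"
      using v y by (auto simp: e_def f_def p_def q_def norm_sgn)
    have ef: "norm (e + f) \<le> \<eta>"
      using norm_sgn_add_sgn_le[OF sum1, of "\<eta> / 8"] small \<eta> by (simp add: e_def f_def)
    have ep: "1 - \<eta>\<^sup>2 / 2 \<le> inner e p" and fq: "1 - \<eta>\<^sup>2 / 2 \<le> inner f q"
    proof -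
      have "inner (sgn v) (sgn w) = inner v w / (norm v * norm w)" for v w :: 'a
        by (simp add: sgn_div_norm divide_inverse)
      then show "1 - \<eta>\<^sup>2 / 2 \<le> inner e p" "1 - \<eta>\<^sup>2 / 2 \<le> inner f q"
        using ang \<delta>(3) by (simp_all add: e_def f_def p_def q_def)
    qed
    \<comment> \<open>If \<open>t\<close> is nearly opposite to \<open>s\<close>, then so is every unit vector near \<open>t\<close>.\<close>
    have cross: "inner s t' \<le> - (1 - 2 * \<eta>)"
      if "norm s = 1" "norm t = 1" "norm t' = 1" "norm (s + t) \<le> \<eta>" "1 - \<eta>\<^sup>2 / 2 \<le> inner t t'"
      for s t t' :: 'a
    proof -
      have "norm (t - t') \<le> \<eta>" using that \<eta> by (intro norm_diff_le_unit) auto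
      then have "inner s (t' - t) \<le> \<eta>"
        using norm_cauchy_schwarz[of s "t' - t"] that(1) by (simp add: norm_minus_commute)
      moreover have "inner s (s + t) \<le> \<eta>"
        using norm_cauchy_schwarz[of s "s + t"] that(1,4) by simp
      moreover have "inner s s = 1" using that(1) by (simp add: norm_eq_1)
      ultimately show ?thesis by (simp add: inner_diff_right inner_add_right)
    qed
    have eq: "inner e q \<le> - \<beta>" using cross[of e f q] unit ef fq \<eta>(3) by simp
    have fp: "inner f p \<le> - \<beta>" using cross[of f e p] unit ef ep \<eta>(3) by (simp add: add.commute)
    have ep': "\<beta> \<le> inner e p" and fq': "\<beta> \<le> inner f q"
      using ep fq \<open>\<eta>\<^sup>2 \<le> \<eta>\<close> \<eta> by auto
    define r s where "r = norm (y - a)" and "s = norm (y - b)"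
    have rs: "0 \<le> r" "0 \<le> s" by (auto simp: r_def s_def)
    have ba: "b - a = r *\<^sub>R p - s *\<^sub>R q"
      using y by (simp add: r_def s_def p_def q_def sgn_div_norm)
    have "norm (a - b) \<le> r + s"
      using norm_triangle_ineq4[of "y - b" "y - a"] by (simp add: r_def s_def norm_minus_commute)
    then have le: "\<beta> * norm (a - b) \<le> \<beta> * r + \<beta> * s"
      using \<beta> by (simp flip: distrib_left)
    have "\<beta> * r + \<beta> * s \<le> inner (b - a) e"
      using mult_left_mono[OF ep' rs(1)] mult_left_mono[OF eq rs(2)]
      unfolding ba by (simp add: inner_diff_left inner_commute algebra_simps)
    with le have 1: "\<beta> * norm (a - b) \<le> inner (b - a) e" by linarith
    have "\<beta> * r + \<beta> * s \<le> - inner (b - a) f"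
      using mult_left_mono[OF fq' rs(2)] mult_left_mono[OF fp rs(1)]
      unfolding ba by (simp add: inner_diff_left inner_commute algebra_simps)
    with le have 2: "\<beta> * norm (a - b) \<le> inner (a - b) f" by (simp add: inner_diff_left)
    have "0 < norm (a - b)" using ab by auto
    then have "\<beta> \<le> inner (b - a) e / norm (a - b)" "\<beta> \<le> inner (a - b) f / norm (a - b)"
      using 1 2 by (simp_all only: pos_le_divide_eq)
    then have "\<beta> \<le> inner ((b - a) /\<^sub>R norm (a - b)) e" "\<beta> \<le> inner ((a - b) /\<^sub>R norm (a - b)) f"
      by (simp_all only: inner_scaleR_left divide_inverse_commute)
    moreover have "min (inner ((b - a) /\<^sub>R norm (a - b)) e) (inner ((a - b) /\<^sub>R norm (a - b)) f) < \<beta>"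
      using ab \<delta>(2) v unit unfolding e_def f_def
      by (intro d sgn_in_frechet_normal_cone) auto
    ultimately show False by simp
  qed
  moreover have "0 < \<eta> / 8" "\<eta> / 8 < 1" using \<eta> by auto
  ultimately show ?thesis
    unfolding intrinsically_transversal_def using \<delta>(1) by blast
qed

theorem theorem9:
  fixes A B :: "'a::euclidean_space set" and xbar :: 'a
  assumes "closed A" and "closed B" and "xbar \<in> A \<inter> B"
  shows "(intrinsically_transversal A B xbar \<longleftrightarrow> itr1 A B xbar > 0) \<and>
    (intrinsically_transversal A B xbar \<longleftrightarrow> itr2 A B xbar < 1) \<and>
    (itr1 A B xbar > 0 \<longleftrightarrow> (\<exists>\<alpha>. \<alpha> \<in> itr1_dist_bounds A B xbar)) \<and>
    (itr1 A B xbar > 0 \<longleftrightarrow> (\<exists>\<alpha>. \<alpha> \<in> itr1_norm_bounds A B xbar)) \<and>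
    sup0 (itr1_dist_bounds A B xbar) = itr1 A B xbar \<and>
    sup0 (itr1_norm_bounds A B xbar) = itr1 A B xbar \<and>
    (itr2 A B xbar < 1 \<longleftrightarrow> (\<exists>\<alpha>. \<alpha> \<in> itr2_bounds A B xbar)) \<and>
    inf1 (itr2_bounds A B xbar) = itr2 A B xbar"
proof -
  note lower = itr1_dist_bounds_supset[of A B xbar]
  note middle = itr1_dist_bounds_subset_norm_bounds[of A B xbar]
  note upper = itr1_norm_bounds_subset[of A B xbar]
  have pos: "\<exists>\<alpha>. \<alpha> \<in> itr1_dist_bounds A B xbar" if "itr1 A B xbar > 0"
    using lower dense[OF that] by fastforce
  have dist: "itr1 A B xbar > 0 \<longleftrightarrow> (\<exists>\<alpha>. \<alpha> \<in> itr1_dist_bounds A B xbar)"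
    using pos middle upper by fastforce
  have norm: "itr1 A B xbar > 0 \<longleftrightarrow> (\<exists>\<alpha>. \<alpha> \<in> itr1_norm_bounds A B xbar)"
    using pos middle upper by fastforce
  have angle: "itr2 A B xbar < 1 \<longleftrightarrow> (\<exists>\<alpha>. \<alpha> \<in> itr2_bounds A B xbar)"
    using itr2_bounds_supset[of A B xbar] itr2_bounds_subset[of A B xbar]
      dense[of "itr2 A B xbar" 1] by fastforce
  have trans: "intrinsically_transversal A B xbar \<longleftrightarrow> (\<exists>\<alpha>. \<alpha> \<in> itr2_bounds A B xbar)"
    using intrinsically_transversal_imp_itr2_bounds itr2_bounds_imp_intrinsically_transversal
    by blast
  have "sup0 (itr1_dist_bounds A B xbar) = itr1 A B xbar"
    using lower middle upper itr1_nonneg by (intro sup0_eqI) auto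
  moreover have "sup0 (itr1_norm_bounds A B xbar) = itr1 A B xbar"
    using lower middle upper itr1_nonneg by (intro sup0_eqI) auto
  moreover have "inf1 (itr2_bounds A B xbar) = itr2 A B xbar"
    by (intro inf1_eqI itr2_bounds_supset itr2_bounds_subset itr2_le_1)
  ultimately show ?thesis
    using dist norm angle trans itr2_bounds_nonempty_iff by blast
qed

end
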